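(* Let $K$ be a $2$-geodetic orientation of a complete bipartite graph $K_{s,t}$ with partite sets $X$ and $Y$, where $s \geq t \geq 2$. Then all arcs of $K$ are oriented in the same direction between the partite sets (all from $X$ to $Y$, or all from $Y$ to $X$), except for the arcs of a matching (possibly of size zero) which are oriented in the opposite direction.
   Context: A digraph has a vertex set and an arc set consisting of ordered pairs of distinct vertices. A walk of length $\ell$ is a sequence $x_0x_1\dots x_\ell$ of vertices with $x_i \rightarrow x_{i+1}$ for all $i$. A digraph is $k$-geodetic if for every ordered pair $(u,v)$ of (not necessarily distinct) vertices there is at most one $u,v$-walk of length at most $k$. An orientation of an undirected graph is obtained by assigning a direction to each edge. *)

theory Defs
  imports "Graph_Theory.Graph_Theory"
begin

text \<open>
  Digraphs are represented by the library type of digraphs without parallel arcs, where an arc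
  is an ordered pair of vertices. As usual in this library, an undirected graph is a symmetric
  loop-free digraph, i.e. the edge \<open>uv\<close> is represented by the two arcs \<open>(u, v)\<close> and \<open>(v, u)\<close>.
\<close>

text \<open>
  Walks are vertex sequences; the one-element sequence is the walk of length \<open>0\<close>, so for
  \<open>u = v\<close> the condition excludes closed walks of length between \<open>1\<close> and \<open>k\<close>.
\<close>

definition k_geodetic :: "nat \<Rightarrow> 'a pair_pre_digraph \<Rightarrow> bool" where
  "k_geodetic k D \<longleftrightarrow>
     (\<forall>u \<in> pverts D. \<forall>v \<in> pverts D.
        \<exists>\<^sub>\<le>\<^sub>1 p. vwalk p (with_proj D) \<and> hd p = u \<and> last p = v \<and> vwalk_length p \<le> k)"

definition orientation_of :: "'a pair_pre_digraph \<Rightarrow> 'a pair_pre_digraph \<Rightarrow> bool" where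
  "orientation_of D G \<longleftrightarrow>
     pverts D = pverts G \<and> parcs D \<subseteq> parcs G \<and>
     (\<forall>(u, v) \<in> parcs G. (u, v) \<in> parcs D \<longleftrightarrow> (v, u) \<notin> parcs D)"

definition partite_sets :: "'a pair_pre_digraph \<Rightarrow> 'a set \<Rightarrow> 'a set \<Rightarrow> bool" where
  "partite_sets G X Y \<longleftrightarrow>
     pverts G = X \<union> Y \<and> X \<inter> Y = {} \<and> parcs G \<subseteq> X \<times> Y \<union> Y \<times> X"

text \<open>
  A set of arcs, no two of which have a common end-vertex. In a symmetric digraph such a set
  contains at most one of the two arcs representing an edge.
\<close>

definition is_matching :: "'a pair_pre_digraph \<Rightarrow> 'a rel \<Rightarrow> bool" where
  "is_matching D M \<longleftrightarrow>
     M \<subseteq> parcs D \<and> pairwise (\<lambda>e f. {fst e, snd e} \<inter> {fst f, snd f} = {}) M"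

lemma pair_digraph_orientation_of:
  assumes "pair_graph G" and "orientation_of D G"
  shows "pair_digraph D"
proof -
  interpret pair_graph G by fact
  have D: "pverts D = pverts G" "parcs D \<subseteq> parcs G"
    using assms(2) by (auto simp: orientation_of_def)
  show ?thesis
  proof
    fix e assume "e \<in> parcs D"
    with D have "e \<in> parcs G" by auto
    then show "fst e \<in> pverts D" "snd e \<in> pverts D" "fst e \<noteq> snd e"
      using D by (auto simp: arc_fst_in_verts arc_snd_in_verts pair_no_loops)
  qed (use D in \<open>auto intro: finite_subset\<close>)
qed

end

theory Submission
  imports Defs
begin

text \<open>
  Record the arcs from \<open>X\<close> to \<open>Y\<close> as a 0/1 matrix. Two walks of length \<open>2\<close> with the same ends
  amount to a \<open>2 \<times> 2\<close> submatrix with a row \<open>11\<close> and a row \<open>00\<close> (ends in \<open>X\<close>), or with a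
  column \<open>11\<close> and a column \<open>00\<close> (ends in \<open>Y\<close>). If row \<open>x\<close> contains two ones, then every
  row has a one in one of these two columns, and so two zeros on a common line anywhere in the
  matrix produce a forbidden submatrix. By transposition the same holds for two ones in a column.
  Hence either the ones or the zeros form a matching.
\<close>

lemma two_geodeticD:
  assumes "k_geodetic 2 K"
    and arcs: "(u, a) \<in> parcs K" "(a, v) \<in> parcs K" "(u, b) \<in> parcs K" "(b, v) \<in> parcs K"
    and verts: "{u, v, a, b} \<subseteq> pverts K"
  shows "a = b"
proof -
  have "vwalk [u, a, v] (with_proj K)" "vwalk [u, b, v] (with_proj K)"
    using arcs verts by (auto simp: vwalk_def)
  moreover have "\<exists>\<^sub>\<le>\<^sub>1 p. vwalk p (with_proj K) \<and> hd p = u \<and> last p = v \<and> vwalk_length p \<le> 2"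
    using assms(1) verts by (auto simp: k_geodetic_def)
  ultimately have "[u, a, v] = [u, b, v]"
    by (elim Uniq_D) (auto simp: vwalk_length_def)
  then show ?thesis by simp
qed

text \<open>The predicate \<open>complete_bipartite_digraph\<close> only yields some bipartition
  \<open>U\<close>, \<open>V\<close>. Connectedness makes it agree with \<open>X\<close>,
  \<open>Y\<close> up to a swap: a vertex of \<open>U\<close> forces all of \<open>V\<close> to the
  opposite side, and a vertex of \<open>V\<close> then does the same to \<open>U\<close>.\<close>

lemma complete_bipartite_arcs:
  assumes "complete_bipartite_digraph s t (with_proj G)" and "partite_sets G X Y"
    and "s \<ge> 1" and "t \<ge> 1"
  shows "parcs G = X \<times> Y \<union> Y \<times> X"
proof -
  obtain U V where UV: "pverts G = U \<union> V" "U \<inter> V = {}" "card U = s" "card V = t"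
    "parcs G = U \<times> V \<union> V \<times> U"
    using assms(1) unfolding complete_bipartite_digraph_def by auto
  obtain u v where u: "u \<in> U" and v: "v \<in> V"
    using UV assms(3,4) by (metis card.empty ex_in_conv not_one_le_zero)
  have XY: "U \<union> V = X \<union> Y" "X \<inter> Y = {}" "U \<times> V \<union> V \<times> U \<subseteq> X \<times> Y \<union> Y \<times> X"
    using assms(2) UV by (auto simp: partite_sets_def)
  have "u \<in> X \<or> u \<in> Y" using XY u by blast
  then have "U = X \<and> V = Y \<or> U = Y \<and> V = X"
  proof
    assume "u \<in> X"
    then have "V \<subseteq> Y" using XY u by blast
    moreover from this have "U \<subseteq> X" using XY v by blast
    ultimately show ?thesis using XY by blast
  next
    assume "u \<in> Y"
    then have "V \<subseteq> X" using XY u by blast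
    moreover from this have "U \<subseteq> Y" using XY v by blast
    ultimately show ?thesis using XY by blast
  qed
  then show ?thesis using UV by blast
qed

definition partial_matching :: "('a \<times> 'b) set \<Rightarrow> bool" where
  "partial_matching R \<longleftrightarrow> single_valued R \<and> single_valued (R\<inverse>)"

definition no_split_square :: "'a set \<Rightarrow> 'b set \<Rightarrow> ('a \<times> 'b) set \<Rightarrow> bool" where
  "no_split_square X Y R \<longleftrightarrow>
     (\<forall>x\<in>X. \<forall>x'\<in>X. \<forall>y\<in>Y. \<forall>y'\<in>Y.
        (x, y) \<in> R \<longrightarrow> (x, y') \<in> R \<longrightarrow> (x', y) \<notin> R \<longrightarrow> (x', y') \<notin> R \<longrightarrow> y = y') \<and>
     (\<forall>x\<in>X. \<forall>x'\<in>X. \<forall>y\<in>Y. \<forall>y'\<in>Y.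
        (x, y) \<in> R \<longrightarrow> (x', y) \<in> R \<longrightarrow> (x, y') \<notin> R \<longrightarrow> (x', y') \<notin> R \<longrightarrow> x = x')"

text \<open>Transposition exchanges the two conjuncts, so results on rows carry over to
  columns.\<close>

lemma no_split_square_converse: "no_split_square Y X (R\<inverse>) \<longleftrightarrow> no_split_square X Y R"
  unfolding no_split_square_def by simp blast

lemma row_ones_imp_zeros_matching:
  assumes sq: "no_split_square X Y R" and R: "R \<subseteq> X \<times> Y"
    and X: "\<And>x. \<exists>x'\<in>X. x' \<noteq> x"
    and "\<not> single_valued R"
  shows "partial_matching (X \<times> Y - R)"
proof -
  obtain x y y' where xy: "(x, y) \<in> R" "(x, y') \<in> R" "y \<noteq> y'"
    using assms(4) by (auto simp: single_valued_def)
  have mem: "x \<in> X" "y \<in> Y" "y' \<in> Y" using xy R by auto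
  have rows: False if "a \<in> X" "a' \<in> X" "b \<in> Y" "b' \<in> Y" "b \<noteq> b'"
      "(a, b) \<in> R" "(a, b') \<in> R" "(a', b) \<notin> R" "(a', b') \<notin> R" for a a' b b'
    using sq that unfolding no_split_square_def by blast
  have cols: False if "a \<in> X" "a' \<in> X" "b \<in> Y" "b' \<in> Y" "a \<noteq> a'"
      "(a, b) \<in> R" "(a', b) \<in> R" "(a, b') \<notin> R" "(a', b') \<notin> R" for a a' b b'
    using sq that unfolding no_split_square_def by blast
  \<comment> \<open>A row 00 in columns \<open>y\<close>, \<open>y'\<close> would clash with the 11
    of row \<open>x\<close>, so \<open>c\<close> can be taken from these two.\<close>
  have other: "\<exists>c\<in>Y. (x, c) \<in> R \<and> (r, c) \<in> R" if "r \<in> X" for r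
    using rows[of x r y y'] xy mem that by blast
  have "z = z'" if "r \<in> X" "z \<in> Y" "z' \<in> Y" "(r, z) \<notin> R" "(r, z') \<notin> R" for r z z'
  proof (rule ccontr)
    assume "z \<noteq> z'"
    show False
    proof (cases "r = x")
      case True
      \<comment> \<open>Here the zeros lie in row \<open>x\<close> itself, so a second row is needed
        for comparison. It cannot be 11 in columns \<open>z\<close>, \<open>z'\<close>, hence shares
        a zero with row \<open>x\<close> there; with the common one in column \<open>c\<close> this
        splits two columns.\<close>
      obtain x' where x': "x' \<in> X" "x' \<noteq> x" using X by blast
      obtain c where "c \<in> Y" "(x, c) \<in> R" "(x', c) \<in> R" using other x' by blast
      moreover have "(x', z) \<notin> R \<or> (x', z') \<notin> R"
        using rows[of x' x z z'] x' that True \<open>z \<noteq> z'\<close> by blast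
      ultimately show False
        using cols[of x x' c z] cols[of x x' c z'] x' that True mem by blast
    next
      case False
      obtain c where "c \<in> Y" "(x, c) \<in> R" "(r, c) \<in> R" using other \<open>r \<in> X\<close> by blast
      moreover have "(x, z) \<notin> R \<or> (x, z') \<notin> R"
        using rows[of x r z z'] that mem \<open>z \<noteq> z'\<close> by blast
      ultimately show False
        using cols[of x r c z] cols[of x r c z'] that False mem by blast
    qed
  qed
  moreover have "r = r'" if r: "r \<in> X" "r' \<in> X" "z \<in> Y" "(r, z) \<notin> R" "(r', z) \<notin> R" for r r' z
  proof (rule ccontr)
    assume ne: "r \<noteq> r'"
    show False
    proof (cases "(x, z) \<in> R")
      case True
      \<comment> \<open>Take for \<open>c\<close> whichever of \<open>y\<close>, \<open>y'\<close>
        differs from \<open>z\<close>. Rows \<open>r\<close> and \<open>r'\<close> are 0 in column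
        \<open>z\<close>, where row \<open>x\<close> is 1, so comparison with row \<open>x\<close>
        forces a 1 in column \<open>c\<close>.\<close>
      obtain c where c: "c \<in> Y" "(x, c) \<in> R" "c \<noteq> z" using xy mem by blast
      then have "(r, c) \<in> R" "(r', c) \<in> R"
        using rows[of x r c z] rows[of x r' c z] that mem True by blast+
      then show False using cols[of r r' c z] c that ne by blast
    next
      case False
      \<comment> \<open>At least one of \<open>r\<close>, \<open>r'\<close> is not \<open>x\<close>;
        that row shares with row \<open>x\<close> the zero in column \<open>z\<close> and a one in
        column \<open>c\<close>.\<close>
      obtain q where q: "q \<in> X" "q \<noteq> x" "(q, z) \<notin> R" using r ne by blast
      obtain c where "c \<in> Y" "(x, c) \<in> R" "(q, c) \<in> R" using other q by blast
      then show False using cols[of x q c z] q that mem False by blast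
    qed
  qed
  ultimately show ?thesis
    by (auto simp: partial_matching_def single_valued_def)
qed

lemma ones_or_zeros_matching:
  assumes sq: "no_split_square X Y R" and R: "R \<subseteq> X \<times> Y"
    and X: "\<And>x. \<exists>x'\<in>X. x' \<noteq> x" and Y: "\<And>y. \<exists>y'\<in>Y. y' \<noteq> y"
  shows "partial_matching R \<or> partial_matching (X \<times> Y - R)"
proof (rule disjCI)
  assume nz: "\<not> partial_matching (X \<times> Y - R)"
  \<comment> \<open>The zeros of the transposed matrix are the transposed zeros, so the row lemma
    also applies to two ones in a column.\<close>
  have "(Y \<times> X - R\<inverse>) = (X \<times> Y - R)\<inverse>" by auto
  with nz have "\<not> partial_matching (Y \<times> X - R\<inverse>)" by (auto simp: partial_matching_def)
  then have "single_valued (R\<inverse>)"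
    using row_ones_imp_zeros_matching[of Y X "R\<inverse>"] sq R Y
    by (auto simp: no_split_square_converse)
  moreover have "single_valued R"
    using row_ones_imp_zeros_matching[OF sq R X] nz by blast
  ultimately show "partial_matching R" by (simp add: partial_matching_def)
qed

text \<open>Two arcs of \<open>M\<close> can only meet in their tails or in their heads, because
  \<open>X\<close> and \<open>Y\<close> are disjoint; \<open>partial_matching\<close> excludes
  both.\<close>

lemma is_matching_bipartite:
  assumes "M \<subseteq> parcs K" "M \<subseteq> X \<times> Y" "X \<inter> Y = {}" "partial_matching M"
  shows "is_matching K M"
  unfolding is_matching_def pairwise_def
proof (intro conjI ballI impI)
  fix e f assume ef: "e \<in> M" "f \<in> M" "e \<noteq> f"
  then obtain a b c d where [simp]: "e = (a, b)" "f = (c, d)" by (meson surj_pair)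
  have "a \<in> X" "b \<in> Y" "c \<in> X" "d \<in> Y" using ef assms(2) by auto
  moreover have "a \<noteq> c" "b \<noteq> d"
    using ef assms(4) by (auto simp: partial_matching_def single_valued_def)
  ultimately show "{fst e, snd e} \<inter> {fst f, snd f} = {}" using assms(3) by auto
qed (fact assms(1))

theorem theorem12:
  fixes G K :: "'a pair_pre_digraph" and X Y :: "'a set" and s t :: nat
  assumes "complete_bipartite_digraph s t (with_proj G)"
    and "partite_sets G X Y" and "card X = s" and "card Y = t"
    and "s \<ge> t" and "t \<ge> 2"
    and "orientation_of K G"
    and "k_geodetic 2 K"
  shows "\<exists>M. is_matching K M \<and>
           ((parcs K - M \<subseteq> X \<times> Y \<and> M \<subseteq> Y \<times> X) \<or>
            (parcs K - M \<subseteq> Y \<times> X \<and> M \<subseteq> X \<times> Y))"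
proof -
  have G: "parcs G = X \<times> Y \<union> Y \<times> X"
    using complete_bipartite_arcs[OF assms(1,2)] assms(5,6) by linarith
  have disj: "X \<inter> Y = {}" and KV: "pverts K = X \<union> Y"
    using assms(2,7) by (auto simp: partite_sets_def orientation_of_def)
  have KA: "parcs K \<subseteq> X \<times> Y \<union> Y \<times> X"
    using assms(7) G by (auto simp: orientation_of_def)
  have rev: "(y, x) \<in> parcs K \<longleftrightarrow> (x, y) \<notin> parcs K" if "x \<in> X" "y \<in> Y" for x y
    using assms(7) G that by (fastforce simp: orientation_of_def)
  have other: "\<exists>a'\<in>A. a' \<noteq> a" if "card A \<ge> 2" for a and A :: "'a set"
  proof (rule ccontr)
    assume "\<not> ?thesis"
    then have "card A \<le> card {a}" by (intro card_mono) auto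
    with that show False by simp
  qed
  define R where "R = parcs K \<inter> X \<times> Y"
  have "no_split_square X Y R"
    unfolding no_split_square_def
  proof (intro conjI ballI impI)
    fix x x' y y' assume mem: "x \<in> X" "x' \<in> X" "y \<in> Y" "y' \<in> Y"
    \<comment> \<open>By \<open>rev\<close>, a zero of \<open>R\<close> is an arc from
      \<open>Y\<close> to \<open>X\<close>. The competing walks are \<open>[x, y, x']\<close> and
      \<open>[x, y', x']\<close>.\<close>
    show "y = y'" if "(x, y) \<in> R" "(x, y') \<in> R" "(x', y) \<notin> R" "(x', y') \<notin> R"
      by (rule two_geodeticD[OF assms(8), of x y x' y'])
        (use that mem rev KV in \<open>auto simp: R_def\<close>)
    \<comment> \<open>The competing walks are \<open>[y', x, y]\<close> and
      \<open>[y', x', y]\<close>.\<close>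
    show "x = x'" if "(x, y) \<in> R" "(x', y) \<in> R" "(x, y') \<notin> R" "(x', y') \<notin> R"
      by (rule two_geodeticD[OF assms(8), of y' x y x'])
        (use that mem rev KV in \<open>auto simp: R_def\<close>)
  qed
  moreover have "R \<subseteq> X \<times> Y" by (auto simp: R_def)
  ultimately have "partial_matching R \<or> partial_matching (X \<times> Y - R)"
    using other assms(3-6) by (intro ones_or_zeros_matching) auto
  then show ?thesis
  proof
    assume "partial_matching R"
    then have "is_matching K R"
      using is_matching_bipartite[of R K X Y] disj by (auto simp: R_def)
    moreover have "parcs K - R \<subseteq> Y \<times> X" "R \<subseteq> X \<times> Y" using KA by (auto simp: R_def)
    ultimately show ?thesis by blast
  next
    assume zeros: "partial_matching (X \<times> Y - R)"
    define M where "M = parcs K \<inter> Y \<times> X"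
    \<comment> \<open>Each zero of the matrix is an edge oriented from \<open>Y\<close> to
      \<open>X\<close>, so the exceptional arcs are the reversed zeros.\<close>
    have "M = (X \<times> Y - R)\<inverse>" using rev by (auto simp: M_def R_def)
    with zeros have "partial_matching M" by (simp add: partial_matching_def)
    then have "is_matching K M"
      using is_matching_bipartite[of M K Y X] disj by (auto simp: M_def)
    moreover have "parcs K - M \<subseteq> X \<times> Y" "M \<subseteq> Y \<times> X" using KA by (auto simp: M_def)
    ultimately show ?thesis by blast
  qed
qed

end
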